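(* Let $\{G_n^*(x)\}$ (of Lucas type) and $\{G_n'(x)\}$ (of Fibonacci type) be equivalent generalized Fibonacci polynomial sequences. If $m$ and $n$ are positive integers, then $$\gcd(G'_m(x),G^*_n(x))=\begin{cases} G^*_{\gcd(m,n)}(x) & \text{if } E_2(m)>E_2(n),\\ \gcd\big(G^*_{\gcd(m,n)}(x),G^*_0(x)\big) & \text{otherwise.}\end{cases}$$
   Context: All polynomials lie in $\mathbb{Z}[x]$ and $\gcd$ denotes the greatest common divisor in $\mathbb{Z}[x]$ (determined up to sign). A generalized Fibonacci polynomial (GFP) sequence $\{G_n(x)\}_{n\ge0}$ is given by $G_0(x)=p_0(x)$, $G_1(x)=p_1(x)$ and $G_n(x)=d(x)G_{n-1}(x)+g(x)G_{n-2}(x)$ for $n\ge 2$, where $p_0(x)$ is a constant and $p_1(x),d(x),g(x)$ are nonzero polynomials in $\mathbb{Z}[x]$ with $\gcd(d(x),g(x))=1$; as in the paper it is assumed that $d(x)^2+4g(x)>0$. Let $a,b$ be the roots of $z^2-d(x)z-g(x)=0$. The sequence is of Lucas type if $p_0\ne 0$, $2p_1(x)=p_0\,d(x)$, $|p_0|\in\{1,2\}$, and $\gcd(p_0,p_1(x))=\gcd(p_0,d(x))=\gcd(p_0,g(x))=1$; then, with $\alpha=2/p_0$, $G_n=(a^n+b^n)/\alpha$ (denoted $G_n^*$). It is of Fibonacci type if $p_0=0$ and $p_1=1$; then $G_n=(a^n-b^n)/(a-b)$ (denoted $G_n'$). A Lucas-type and a Fibonacci-type sequence are equivalent if they are defined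 with the same $d(x)$ and $g(x)$. For a positive integer $n$, $E_2(n)$ is the largest integer $k$ with $2^k\mid n$. *)

theory Defs
  imports Complex_Main "HOL-Computational_Algebra.Computational_Algebra"
begin

text \<open>
  The inequality \<open>d\<^sup>2 + 4g > 0\<close> constrains the real arguments \<open>x\<close> at which \<open>d\<close> and \<open>g\<close> are
  evaluated, so that \<open>z\<^sup>2 - d(x) z - g(x)\<close> has two distinct real roots there. It cannot be meant
  for every real \<open>x\<close>, since that would exclude the Chebyshev (\<open>d = 2x\<close>, \<open>g = -1\<close>), Fermat
  (\<open>d = 3x\<close>, \<open>g = -2\<close>) and Jacobsthal (\<open>d = 1\<close>, \<open>g = 2x\<close>) families. It is therefore read as: the
  inequality holds at some real \<open>x\<close> (by continuity, on a nonempty open interval). This is implied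
  both by positivity everywhere and by positivity for all large \<open>x\<close>.
\<close>

definition pos_discriminant :: "int poly \<Rightarrow> int poly \<Rightarrow> bool" where
  "pos_discriminant d g \<longleftrightarrow> (\<exists>x::real. poly (map_poly of_int (d\<^sup>2 + 4 * g)) x > 0)"

definition is_GFP ::
  "int \<Rightarrow> int poly \<Rightarrow> int poly \<Rightarrow> int poly \<Rightarrow> (nat \<Rightarrow> int poly) \<Rightarrow> bool" where
  "is_GFP p0 p1 d g G \<longleftrightarrow>
     p1 \<noteq> 0 \<and> d \<noteq> 0 \<and> g \<noteq> 0 \<and> gcd d g = 1 \<and> pos_discriminant d g \<and>
     G 0 = [:p0:] \<and> G 1 = p1 \<and> (\<forall>n\<ge>2. G n = d * G (n - 1) + g * G (n - 2))"

definition lucas_type :: "int poly \<Rightarrow> int poly \<Rightarrow> (nat \<Rightarrow> int poly) \<Rightarrow> bool" where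
  "lucas_type d g G \<longleftrightarrow>
     (\<exists>p0 p1. is_GFP p0 p1 d g G \<and> p0 \<noteq> 0 \<and> 2 * p1 = [:p0:] * d \<and> \<bar>p0\<bar> \<in> {1, 2} \<and>
        gcd [:p0:] p1 = 1 \<and> gcd [:p0:] d = 1 \<and> gcd [:p0:] g = 1)"

definition fibonacci_type :: "int poly \<Rightarrow> int poly \<Rightarrow> (nat \<Rightarrow> int poly) \<Rightarrow> bool" where
  "fibonacci_type d g G \<longleftrightarrow> is_GFP 0 1 d g G"

definition equivalent_GFP :: "(nat \<Rightarrow> int poly) \<Rightarrow> (nat \<Rightarrow> int poly) \<Rightarrow> bool" where
  "equivalent_GFP GL GF \<longleftrightarrow> (\<exists>d g. lucas_type d g GL \<and> fibonacci_type d g GF)"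

abbreviation E2 :: "nat \<Rightarrow> nat" where
  "E2 n \<equiv> multiplicity 2 n"

end

theory Submission
  imports Defs
begin

text \<open>
  Write \<open>U\<close> for the Fibonacci-type sequence and \<open>W\<close> for the Lucas-type one, with \<open>W\<^sub>0 = c\<close>,
  \<open>W\<^sub>1 = p\<close> and \<open>2p = cd\<close>. For every solution \<open>X\<close> of the recurrence one has
  \<open>X\<^sub>r\<^sub>+\<^sub>s = X\<^sub>r\<^sub>+\<^sub>1 U\<^sub>s + g X\<^sub>r U\<^sub>s\<^sub>-\<^sub>1\<close>. As \<open>U\<^sub>s\<close> is coprime to \<open>g U\<^sub>s\<^sub>-\<^sub>1\<close>, any divisor of \<open>U\<^sub>s\<close> divides
  \<open>X\<^sub>r\<^sub>+\<^sub>s\<close> iff it divides \<open>X\<^sub>r\<close>. With \<open>X = U\<close> this gives strong divisibility of \<open>U\<close>. Since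
  \<open>W\<^sub>n\<close> divides \<open>U\<^sub>2\<^sub>n\<close>, a common divisor of \<open>U\<^sub>m\<close> and \<open>W\<^sub>n\<close> divides \<open>U\<^sub>t\<close> with \<open>t = gcd m (2n)\<close>.
  Put \<open>k = gcd m n\<close>. If \<open>E\<^sub>2(m) > E\<^sub>2(n)\<close>, then \<open>t = 2k\<close> and \<open>n\<close> is \<open>k\<close> plus a multiple of \<open>2k\<close>, so
  the shift rule with \<open>X = W\<close> exchanges \<open>W\<^sub>n\<close> and \<open>W\<^sub>k\<close>. Otherwise \<open>t = k\<close>, the shift
  rule exchanges \<open>W\<^sub>n\<close>, \<open>W\<^sub>k\<close> and \<open>W\<^sub>0\<close> for divisors of \<open>U\<^sub>k\<close>, and \<open>W\<^sub>k = c U\<^sub>k\<^sub>+\<^sub>1 - p U\<^sub>k\<close>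
  with \<open>gcd c p = 1\<close> shows that a common divisor of \<open>W\<^sub>k\<close> and \<open>W\<^sub>0\<close> divides \<open>U\<^sub>k\<close>.
\<close>

text \<open>Cancelling \<open>gcd m n\<close> leaves coprime cofactors; the 2-adic condition makes
  that of \<open>m\<close> even, hence that of \<open>n\<close> odd.\<close>

lemma gcd_double_right_if_E2_less:
  fixes m n :: nat
  assumes "m > 0" "n > 0" "E2 n < E2 m"
  shows "gcd m (2 * n) = 2 * gcd m n" "odd (n div gcd m n)"
proof -
  define k where "k = gcd m n"
  obtain a b where ab: "m = k * a" "n = k * b" "coprime a b"
    using gcd_coprime_exists[of m n] assms(1) unfolding k_def
    by (auto simp: mult.commute)
  have pos: "k > 0" "a > 0" "b > 0"
    using ab assms by auto
  have "E2 b < E2 a"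
    using assms(3) pos by (simp add: ab prime_elem_multiplicity_mult_distrib)
  then have "even a"
    by (metis not_less_zero not_dvd_imp_multiplicity_0)
  then have "odd b"
    using ab(3) coprime_common_divisor[of a b 2] by auto
  obtain a' where a': "a = 2 * a'"
    using \<open>even a\<close> by blast
  have "coprime a' b"
    using ab(3) a' by simp
  have "gcd m (2 * n) = (2 * k) * gcd a' b"
    by (simp add: ab(1,2) a' gcd_mult_distrib_nat mult.left_commute[of k 2] mult.assoc)
  with \<open>coprime a' b\<close> show "gcd m (2 * n) = 2 * gcd m n"
    by (simp add: k_def)
  show "odd (n div gcd m n)"
    using \<open>odd b\<close> ab(2) pos unfolding k_def[symmetric] by simp
qed

lemma gcd_double_right_if_E2_le:
  fixes m n :: nat
  assumes "m > 0" "n > 0" "E2 m \<le> E2 n"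
  shows "gcd m (2 * n) = gcd m n"
proof -
  define k where "k = gcd m n"
  obtain a b where ab: "m = k * a" "n = k * b" "coprime a b"
    using gcd_coprime_exists[of m n] assms(1) unfolding k_def
    by (auto simp: mult.commute)
  have pos: "k > 0" "a > 0" "b > 0"
    using ab assms by auto
  have le: "E2 a \<le> E2 b"
    using assms(3) pos by (simp add: ab prime_elem_multiplicity_mult_distrib)
  have "odd a"
  proof
    assume "even a"
    then have "E2 a > 0"
      using pos by (simp add: prime_multiplicity_gt_zero_iff)
    with le have "even b"
      by (metis not_dvd_imp_multiplicity_0 not_less_zero le_zero_eq)
    with \<open>even a\<close> ab(3) show False
      using coprime_common_divisor[of a b 2] by auto
  qed
  with ab(3) have "coprime a (2 * b)"
    by simp
  have "gcd m (2 * n) = k * gcd a (2 * b)"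
    by (simp add: ab(1,2) gcd_mult_distrib_nat mult.left_commute[of 2 k])
  with \<open>coprime a (2 * b)\<close> show ?thesis
    by (simp add: k_def)
qed

locale fibonacci_recurrence =
  fixes d g :: "'a :: factorial_ring_gcd" and U :: "nat \<Rightarrow> 'a"
  assumes coprime_d_g: "coprime d g"
    and U_0 [simp]: "U 0 = 0"
    and U_1 [simp]: "U (Suc 0) = 1"
    and U_Suc_Suc: "U (Suc (Suc n)) = d * U (Suc n) + g * U n"
begin

definition solution :: "(nat \<Rightarrow> 'a) \<Rightarrow> bool" where
  "solution X \<longleftrightarrow> (\<forall>n. X (Suc (Suc n)) = d * X (Suc n) + g * X n)"

lemma solution_U: "solution U"
  by (simp add: solution_def U_Suc_Suc)

text \<open>Writing \<open>Suc s\<close> avoids \<open>U\<close> at index -1; the induction moves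
  one unit from \<open>s\<close> to \<open>r\<close>.\<close>

lemma solution_add:
  assumes "solution X"
  shows "X (r + Suc s) = X (Suc r) * U (Suc s) + g * X r * U s"
proof (induction s arbitrary: r)
  case 0
  then show ?case by simp
next
  case (Suc s)
  from Suc[of "Suc r"] assms show ?case
    by (simp add: solution_def U_Suc_Suc algebra_simps)
qed

text \<open>Modulo \<open>g\<close>, \<open>U (Suc n)\<close> is \<open>d ^ n\<close>, and
  \<open>d\<close> is coprime to \<open>g\<close>.\<close>

lemma coprime_U_Suc_g: "coprime (U (Suc n)) g"
proof (induction n)
  case (Suc n)
  have "coprime (d * U (Suc n)) g"
    using Suc coprime_d_g by simp
  moreover have "U (Suc (Suc n)) = U n * g + d * U (Suc n)"
    by (simp add: U_Suc_Suc)
  ultimately show ?case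
    using gcd_add_mult[of g "U n" "d * U (Suc n)"]
    by (simp only: coprime_iff_gcd_eq_1 gcd.commute[of _ g])
qed simp

lemma coprime_U_U_Suc: "coprime (U n) (U (Suc n))"
proof (induction n)
  case (Suc n)
  have "coprime (U (Suc n)) (g * U n)"
    using Suc coprime_U_Suc_g by (simp add: coprime_commute)
  then show ?case
    using gcd_add_mult[of "U (Suc n)" d "g * U n"]
    by (simp only: U_Suc_Suc[of n] coprime_iff_gcd_eq_1)
qed simp

lemma dvd_solution_add_iff:
  assumes "solution X" "e dvd U s"
  shows "e dvd X (r + s) \<longleftrightarrow> e dvd X r"
proof (cases s)
  case (Suc t)
  have cop: "coprime e (g * U t)"
  proof (rule coprime_divisors[OF _ dvd_refl])
    show "coprime (U s) (g * U t)"
      using coprime_U_Suc_g[of t] coprime_U_U_Suc[of t] Suc by (simp add: coprime_commute)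
  qed (rule assms(2))
  have "e dvd X (r + s) \<longleftrightarrow> e dvd X r * (g * U t)"
    using assms(2) unfolding Suc solution_add[OF assms(1)]
    by (subst dvd_add_right_iff) (auto simp: ac_simps)
  also have "\<dots> \<longleftrightarrow> e dvd X r"
    using cop by (simp add: coprime_dvd_mult_left_iff)
  finally show ?thesis .
qed simp

lemma U_dvd_U_mult: "U n dvd U (q * n)"
proof (induction q)
  case (Suc q)
  then show ?case
    using dvd_solution_add_iff[OF solution_U, of "U n" n "q * n"] by (simp add: add.commute)
qed simp

lemma U_dvd_U: "m dvd n \<Longrightarrow> U m dvd U n"
  using U_dvd_U_mult by (metis dvd_div_mult_self)

text \<open>Euclid's algorithm on the indices, each division being a shift by
  \<open>m div n * n\<close>.\<close>

lemma dvd_U_gcd: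
  assumes "e dvd U m" "e dvd U n"
  shows "e dvd U (gcd m n)"
  using assms
proof (induction m n rule: gcd_nat_induct)
  case (step m n)
  have "e dvd U (m div n * n)"
    using step.prems(2) U_dvd_U_mult dvd_trans by blast
  then have "e dvd U (m mod n)"
    using dvd_solution_add_iff[OF solution_U, of e "m div n * n" "m mod n"] step.prems(1)
    by simp
  with step show ?case
    by (simp add: gcd_red_nat[of m n])
qed simp

end

locale equivalent_lucas = fibonacci_recurrence +
  fixes W :: "nat \<Rightarrow> 'a" and c p \<alpha> :: 'a
  assumes solution_W: "solution W"
    and W_0: "W 0 = c" and W_1: "W (Suc 0) = p"
    and coprime_c_p: "coprime c p"
    and \<alpha>_c: "\<alpha> * c = 2" and \<alpha>_p: "\<alpha> * p = d"
begin

lemma p_double: "c * d = p + p"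
  by (metis \<alpha>_c \<alpha>_p mult.assoc mult.commute mult_2)

text \<open>Both sides solve the recurrence; they agree at 1 because
  \<open>c * d - p = p\<close>.\<close>

lemma W_eq: "W n = c * U (Suc n) - p * U n"
proof (induction n rule: less_induct)
  case (less n)
  consider "n = 0" | "n = 1" | j where "n = Suc (Suc j)"
    by (metis One_nat_def not0_implies_Suc)
  then show ?case
  proof cases
    case 2
    then show ?thesis
      by (simp add: W_1 U_Suc_Suc p_double)
  next
    case 3
    have "W n = d * W (Suc j) + g * W j"
      using solution_W 3 by (simp add: solution_def)
    also have "\<dots> = d * (c * U (Suc (Suc j)) - p * U (Suc j)) + g * (c * U (Suc j) - p * U j)"
      using less 3 by simp
    also have "\<dots> = c * U (Suc n) - p * U n"
      by (simp add: 3 U_Suc_Suc algebra_simps)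
    finally show ?thesis .
  qed (simp add: W_0)
qed

text \<open>The cofactor is \<open>\<alpha> * U n\<close>, as in a^(2n) - b^(2n) = (a^n - b^n)(a^n +
  b^n).\<close>

lemma W_dvd_U_double: "W n dvd U (2 * n)"
proof (cases n)
  case (Suc t)
  have "U (2 * n) = U (Suc n) * U n + g * U n * U t"
    using solution_add[OF solution_U, of n t] Suc by (simp add: mult_2)
  also have "\<dots> = U n * (2 * U (Suc n) - d * U n)"
    by (simp add: Suc U_Suc_Suc algebra_simps)
  also have "2 * U (Suc n) - d * U n = \<alpha> * W n"
    by (simp add: W_eq right_diff_distrib \<alpha>_c \<alpha>_p flip: mult.assoc)
  finally show ?thesis by simp
qed simp

lemma dvd_W_iff_dvd_W_0:
  assumes "e dvd U n"
  shows "e dvd W n \<longleftrightarrow> e dvd W 0"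
  using dvd_solution_add_iff[OF solution_W assms, of 0] by simp

lemma dvd_U_if_dvd_W:
  assumes "e dvd W n" "e dvd W 0"
  shows "e dvd U n"
proof -
  have "e dvd c * U (Suc n) - W n"
    using assms W_0 by auto
  then have "e dvd p * U n"
    by (simp add: W_eq)
  moreover have "coprime e p"
    using coprime_divisors[OF _ dvd_refl coprime_c_p] assms(2) W_0 by simp
  ultimately show ?thesis
    by (simp add: coprime_dvd_mult_right_iff)
qed

text \<open>\<open>gcd\<close> is normalized, while \<open>W\<close> may carry a unit factor such as
  a sign; hence \<open>normalize\<close>.\<close>

theorem gcd_U_W:
  assumes "m > 0" "n > 0"
  shows "gcd (U m) (W n) =
    (if E2 m > E2 n then normalize (W (gcd m n)) else gcd (W (gcd m n)) (W 0))"
proof -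
  define k where "k = gcd m n"
  have U_t: "e dvd U (gcd m (2 * n))" if "e dvd U m" "e dvd W n" for e
    using that dvd_U_gcd W_dvd_U_double dvd_trans by blast
  show ?thesis
  proof (cases "E2 m > E2 n")
    case True
    note t = gcd_double_right_if_E2_less[OF assms True, folded k_def]
    have "n = k * (n div k)"
      by (simp add: k_def)
    moreover obtain q where "n div k = 2 * q + 1"
      using t(2) oddE by blast
    ultimately have q: "n = k + q * (2 * k)"
      by (metis add.commute distrib_left mult.assoc mult.commute mult.right_neutral)
    have W_iff: "e dvd W n \<longleftrightarrow> e dvd W k" if "e dvd U (2 * k)" for e
      unfolding q
      by (rule dvd_solution_add_iff[OF solution_W dvd_trans[OF that U_dvd_U_mult]])
    have "2 * k dvd m"
      using t(1) by (metis gcd_dvd1)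
    then have "W k dvd U m"
      using W_dvd_U_double U_dvd_U dvd_trans by blast
    moreover have "W k dvd W n"
      using W_iff[OF W_dvd_U_double] by simp
    moreover have "e dvd W k" if "e dvd U m" "e dvd W n" for e
      using U_t[OF that] t(1) W_iff that by simp
    ultimately have "normalize (W k) = gcd (U m) (W n)"
      by (intro gcdI) simp_all
    with True show ?thesis
      by (simp add: k_def)
  next
    case False
    then have t: "gcd m (2 * n) = k"
      using gcd_double_right_if_E2_le assms by (simp add: k_def)
    have U_k: "U k dvd U m" "U k dvd U n"
      by (auto simp: k_def intro: U_dvd_U)
    have iff: "e dvd U m \<and> e dvd W n \<longleftrightarrow> e dvd W k \<and> e dvd W 0" for e
    proof
      assume *: "e dvd U m \<and> e dvd W n"
      then have "e dvd U k"
        using U_t t by simp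
      with * show "e dvd W k \<and> e dvd W 0"
        using dvd_W_iff_dvd_W_0 dvd_trans[OF _ U_k(2)] by metis
    next
      assume *: "e dvd W k \<and> e dvd W 0"
      then have "e dvd U k"
        using dvd_U_if_dvd_W by simp
      with * show "e dvd U m \<and> e dvd W n"
        using dvd_W_iff_dvd_W_0 dvd_trans[OF _ U_k(1)] dvd_trans[OF _ U_k(2)] by metis
    qed
    have "gcd (W k) (W 0) = gcd (U m) (W n)"
      using iff[THEN iffD1] iff[THEN iffD2, of "gcd (W k) (W 0)"] by (intro gcdI) simp_all
    with False show ?thesis
      by (simp add: k_def)
  qed
qed

end

theorem theorem18:
  fixes GL GF :: "nat \<Rightarrow> int poly" and m n :: nat
  assumes "equivalent_GFP GL GF"
    and "m > 0" and "n > 0"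
  shows "gcd (GF m) (GL n) =
    (if E2 m > E2 n then normalize (GL (gcd m n))
     else gcd (GL (gcd m n)) (GL 0))"
proof -
  obtain d g p0 p1 where
    L: "is_GFP p0 p1 d g GL" "2 * p1 = [:p0:] * d" "\<bar>p0\<bar> \<in> {1, 2}" "gcd [:p0:] p1 = 1"
    and F: "is_GFP 0 1 d g GF"
    using assms(1) unfolding equivalent_GFP_def lucas_type_def fibonacci_type_def by metis
  have rec: "G (Suc (Suc j)) = d * G (Suc j) + g * G j" if "is_GFP a b d g G" for a b G j
    using that unfolding is_GFP_def by (elim conjE allE[of _ "Suc (Suc j)"]) simp
  interpret fibonacci_recurrence d g GF
    using F rec[OF F] by unfold_locales (auto simp: is_GFP_def coprime_iff_gcd_eq_1)
  \<comment> \<open>The division is exact, as \<open>p0\<close> is 1, -1, 2 or -2.\<close>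
  define a where "a = 2 div p0"
  have a: "a * p0 = 2"
  proof -
    have "p0 \<in> {1, -1, 2, -2}"
      using L(3) by auto
    then show ?thesis
      by (auto simp: a_def)
  qed
  then have ac: "[:a:] * [:p0:] = 2"
    by (simp add: numeral_poly mult.commute)
  have "[:p0:] * ([:a:] * p1) = [:p0:] * d"
    using L(2) ac by (metis mult.assoc mult.commute)
  moreover have "p0 \<noteq> 0"
    using a by auto
  ultimately have ap: "[:a:] * p1 = d"
    by (metis mult_left_cancel pCons_eq_0_iff)
  interpret equivalent_lucas d g GF GL "[:p0:]" p1 "[:a:]"
    using L rec[OF L(1)] ac ap
    by unfold_locales (auto simp: is_GFP_def coprime_iff_gcd_eq_1 solution_def)
  show ?thesis
    using gcd_U_W assms(2,3) by blast
qed

end
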